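(* Let $L_\pm=\mathcal C_\pm\text{-Idl}(B_\pm)$ be the frames generated by frame presentations $(B_+,\mathcal C_+)$, $(B_-,\mathcal C_-)$, with $B_\pm$ identified with its image in $L_\pm$. Let $R\subseteq L_+\times L_-$ be $\sqsubseteq$-downward closed and closed under logical meets and joins, and suppose that for every $\alpha\in\mathcal D^B(R)$ the sets $\mathcal B_+(\alpha_+)$ and $\mathcal B_-(\alpha_-)$ are $R$-independent. Then $\mathcal D(\mathcal D(R))=\mathcal D(R)$.
   Context: A frame presentation $(B,\mathcal C)$ consists of a meet-semilattice $B$ (with top) and a set $\mathcal C$ of pairs $U\dashv a$ with $a\in B$, $U\subseteq\downarrow a$, such that $U\dashv a\in\mathcal C$ and $b\le a$ imply $\{u\wedge b:u\in U\}\dashv b\in\mathcal C$. A $\mathcal C$-ideal is a downset $I\subseteq B$ with: $U\dashv a\in\mathcal C$, $U\subseteq I$ imply $a\in I$; $\mathcal C\text{-Idl}(B)$ is the frame of $\mathcal C$-ideals under inclusion, and $b\in B$ is identified with the smallest $\mathcal C$-ideal containing $b$. On $L_+\times L_-$: $\alpha\sqsubseteq\beta$ iff $\alpha_+\le\beta_+,\alpha_-\le\beta_-$; logical join $\alpha\vee\beta=(\alpha_+\vee\beta_+,\alpha_-\wedge\beta_-)$, logical meet $\alpha\wedge\beta=(\alpha_+\wedge\beta_+,\alpha_-\vee\beta_-)$. $\mathcal D(R)=\{\bigsqcup A: A\subseteq R\ \sqsubseteq\text{-directed}\}$ where $\bigsqcup A=(\bigvee_{\alpha\in A}\alpha_+,\bigvee_{\alpha\in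 A}\alpha_-)$. Sets $A_+\subseteq L_+$, $A_-\subseteq L_-$ are $R$-independent if $(a_+,a_-)\in R$ for all $a_\pm\in A_\pm$. $\mathcal B_\pm(x)=\{b\in B_\pm: b\le x\}$ for $x\in L_\pm$. $\mathcal D^B(R)=\{(\bigvee A_+,\bigvee A_-): A_\pm\subseteq B_\pm,\ A_+,A_-\text{ are }R\text{-independent}\}$. *)

theory Defs
  imports Main
begin

locale frame_presentation =
  fixes C :: "('a::bounded_semilattice_inf_top set \<times> 'a) set"
  assumes cover_below: "(U, a) \<in> C \<Longrightarrow> U \<subseteq> {..a}"
    and cover_stable: "(U, a) \<in> C \<Longrightarrow> b \<le> a \<Longrightarrow> ((\<lambda>u. inf u b) ` U, b) \<in> C"

definition cideal :: "('a::order set \<times> 'a) set \<Rightarrow> 'a set \<Rightarrow> bool" where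
  "cideal C I \<longleftrightarrow>
     (\<forall>x\<in>I. \<forall>y\<le>x. y \<in> I) \<and> (\<forall>U a. (U, a) \<in> C \<longrightarrow> U \<subseteq> I \<longrightarrow> a \<in> I)"

text \<open>The frame of \<open>C\<close>-ideals, ordered by inclusion: binary meets are intersections, joins are
  \<open>cjoin\<close>. That it is a frame with these operations is proved at the end of this theory.\<close>

definition cidl :: "('a::order set \<times> 'a) set \<Rightarrow> 'a set set" where
  "cidl C = {I. cideal C I}"

definition cgen :: "('a::order set \<times> 'a) set \<Rightarrow> 'a set \<Rightarrow> 'a set" where
  "cgen C S = \<Inter>{I \<in> cidl C. S \<subseteq> I}"

definition cjoin :: "('a::order set \<times> 'a) set \<Rightarrow> 'a set set \<Rightarrow> 'a set" where
  "cjoin C F = cgen C (\<Union>F)"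

text \<open>The image of the semilattice in the frame; the map \<open>b \<mapsto> cgen C {b}\<close> need not be
  injective.\<close>

definition cbase :: "('a::order set \<times> 'a) set \<Rightarrow> 'a set set" where
  "cbase C = range (\<lambda>b. cgen C {b})"

definition base_below :: "('a::order set \<times> 'a) set \<Rightarrow> 'a set \<Rightarrow> 'a set set" where
  "base_below C x = {b \<in> cbase C. b \<subseteq> x}"

definition info_le :: "'a set \<times> 'b set \<Rightarrow> 'a set \<times> 'b set \<Rightarrow> bool"  (infix "\<sqsubseteq>" 50) where
  "\<alpha> \<sqsubseteq> \<beta> \<longleftrightarrow> fst \<alpha> \<subseteq> fst \<beta> \<and> snd \<alpha> \<subseteq> snd \<beta>"

definition logical_join ::
  "('a::order set \<times> 'a) set \<Rightarrow> 'a set \<times> 'b set \<Rightarrow> 'a set \<times> 'b set \<Rightarrow> 'a set \<times> 'b set" where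
  "logical_join Cp \<alpha> \<beta> = (cjoin Cp {fst \<alpha>, fst \<beta>}, snd \<alpha> \<inter> snd \<beta>)"

definition logical_meet ::
  "('b::order set \<times> 'b) set \<Rightarrow> 'a set \<times> 'b set \<Rightarrow> 'a set \<times> 'b set \<Rightarrow> 'a set \<times> 'b set" where
  "logical_meet Cm \<alpha> \<beta> = (fst \<alpha> \<inter> fst \<beta>, cjoin Cm {snd \<alpha>, snd \<beta>})"

definition info_directed :: "('a set \<times> 'b set) set \<Rightarrow> bool" where
  "info_directed A \<longleftrightarrow>
     A \<noteq> {} \<and> (\<forall>\<alpha>\<in>A. \<forall>\<beta>\<in>A. \<exists>\<gamma>\<in>A. \<alpha> \<sqsubseteq> \<gamma> \<and> \<beta> \<sqsubseteq> \<gamma>)"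

definition info_Join ::
  "('a::order set \<times> 'a) set \<Rightarrow> ('b::order set \<times> 'b) set \<Rightarrow> ('a set \<times> 'b set) set
    \<Rightarrow> 'a set \<times> 'b set" where
  "info_Join Cp Cm A = (cjoin Cp (fst ` A), cjoin Cm (snd ` A))"

definition dir_closure ::
  "('a::order set \<times> 'a) set \<Rightarrow> ('b::order set \<times> 'b) set \<Rightarrow> ('a set \<times> 'b set) set
    \<Rightarrow> ('a set \<times> 'b set) set" where
  "dir_closure Cp Cm R = {info_Join Cp Cm A |A. A \<subseteq> R \<and> info_directed A}"

definition independent :: "('a set \<times> 'b set) set \<Rightarrow> 'a set set \<Rightarrow> 'b set set \<Rightarrow> bool" where
  "independent R Ap Am \<longleftrightarrow> (\<forall>ap\<in>Ap. \<forall>am\<in>Am. (ap, am) \<in> R)"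

definition base_closure ::
  "('a::order set \<times> 'a) set \<Rightarrow> ('b::order set \<times> 'b) set \<Rightarrow> ('a set \<times> 'b set) set
    \<Rightarrow> ('a set \<times> 'b set) set" where
  "base_closure Cp Cm R =
     {(cjoin Cp Ap, cjoin Cm Am) |Ap Am. Ap \<subseteq> cbase Cp \<and> Am \<subseteq> cbase Cm \<and> independent R Ap Am}"


lemma cidl_Inter: "F \<subseteq> cidl C \<Longrightarrow> \<Inter>F \<in> cidl C"
  unfolding cidl_def cideal_def by blast

lemma cidl_Int: "I \<in> cidl C \<Longrightarrow> J \<in> cidl C \<Longrightarrow> I \<inter> J \<in> cidl C"
  using cidl_Inter[of "{I, J}" C] by simp

lemma cgen_in_cidl: "cgen C S \<in> cidl C"
  unfolding cgen_def by (rule cidl_Inter) blast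

lemma cgen_upper: "S \<subseteq> cgen C S"
  unfolding cgen_def by blast

lemma cgen_least: "I \<in> cidl C \<Longrightarrow> S \<subseteq> I \<Longrightarrow> cgen C S \<subseteq> I"
  unfolding cgen_def by blast

lemma cjoin_in_cidl: "cjoin C F \<in> cidl C"
  unfolding cjoin_def by (rule cgen_in_cidl)

lemma cjoin_upper: "I \<in> F \<Longrightarrow> I \<subseteq> cjoin C F"
  unfolding cjoin_def using cgen_upper[of "\<Union>F" C] by blast

lemma cjoin_least: "J \<in> cidl C \<Longrightarrow> (\<And>I. I \<in> F \<Longrightarrow> I \<subseteq> J) \<Longrightarrow> cjoin C F \<subseteq> J"
  unfolding cjoin_def by (rule cgen_least) blast+

lemma (in frame_presentation) cidl_distrib:
  assumes I: "I \<in> cidl C" and F: "F \<subseteq> cidl C"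
  shows "I \<inter> cjoin C F = cjoin C ((\<lambda>J. I \<inter> J) ` F)"
proof
  let ?K = "cjoin C ((\<lambda>J. I \<inter> J) ` F)"
  define H where "H = {b. \<forall>c\<in>I. inf b c \<in> ?K}"
  have K: "cideal C ?K" using cjoin_in_cidl[of C] unfolding cidl_def by blast
  have down: "y \<in> H" if "x \<in> H" "y \<le> x" for x y
  proof -
    have "inf y c \<in> ?K" if "c \<in> I" for c
    proof -
      have "inf x c \<in> ?K" using \<open>x \<in> H\<close> that unfolding H_def by blast
      moreover have "inf y c \<le> inf x c" using \<open>y \<le> x\<close> by (rule inf_mono) simp
      ultimately show ?thesis using K unfolding cideal_def by blast
    qed
    then show ?thesis unfolding H_def by blast
  qed
  have cov: "a \<in> H" if Ua: "(U, a) \<in> C" and UH: "U \<subseteq> H" for U a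
  proof -
    have "inf a c \<in> ?K" if c: "c \<in> I" for c
    proof -
      have "((\<lambda>u. inf u (inf a c)) ` U, inf a c) \<in> C" using cover_stable[OF Ua] by simp
      moreover have "inf u (inf a c) \<in> ?K" if u: "u \<in> U" for u
      proof -
        have "u \<le> a" using cover_below[OF Ua] u by auto
        then have "inf u (inf a c) = inf u c" by (simp add: inf_absorb1 flip: inf_assoc)
        then show ?thesis using UH u c unfolding H_def by auto
      qed
      ultimately show ?thesis using K unfolding cideal_def by blast
    qed
    then show ?thesis unfolding H_def by blast
  qed
  have "H \<in> cidl C" using down cov unfolding cidl_def cideal_def by blast
  moreover have "J \<subseteq> H" if J: "J \<in> F" for J
  proof
    fix b assume b: "b \<in> J"
    have "inf b c \<in> ?K" if c: "c \<in> I" for c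
    proof -
      have "inf b c \<in> I \<inter> J"
        using I F J b c inf_le1[of b c] inf_le2[of b c] unfolding cidl_def cideal_def by blast
      then show ?thesis using cjoin_upper[of "I \<inter> J" "(\<lambda>J. I \<inter> J) ` F" C] J by blast
    qed
    then show "b \<in> H" unfolding H_def by blast
  qed
  ultimately have "cjoin C F \<subseteq> H" by (rule cjoin_least)
  then have "inf b b \<in> ?K" if "b \<in> I \<inter> cjoin C F" for b
    using that unfolding H_def by blast
  then show "I \<inter> cjoin C F \<subseteq> ?K" by auto
next
  show "cjoin C ((\<lambda>J. I \<inter> J) ` F) \<subseteq> I \<inter> cjoin C F"
    using cjoin_upper[of _ F C] by (intro cjoin_least cidl_Int I cjoin_in_cidl) auto
qed

end

theory Submission
  imports Defs
begin

text \<open>If every base element below \<open>\<alpha>\<^sub>+\<close> is \<open>R\<close>-related to every base element below \<open>\<alpha>\<^sub>-\<close>, then, by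
  logical joins and meets, so are their finite joins, and these form a directed subset of \<open>R\<close> with
  join \<open>\<alpha>\<close>. This independence passes to directed joins: the union of the base elements below the
  members of the directed set is independent by directedness, and the hypothesis on
  \<open>base_closure\<close> extends it to all base elements below the join. Hence it holds on \<open>D(R)\<close> and on
  \<open>D(D(R))\<close>.

  The empty set can be an ideal, and then it has no base elements below it. So nonempty finite
  joins of base elements only work if both components of \<open>\<alpha>\<close> are nonempty. If one is empty,
  the set of all elements of \<open>R\<close> below \<open>\<alpha>\<close> is itself directed.\<close>

section \<open>Information order, joins of pairs and the directed closure\<close>

lemma info_le_refl: "\<alpha> \<sqsubseteq> \<alpha>"
  by (simp add: info_le_def)

lemma info_le_trans: "\<alpha> \<sqsubseteq> \<beta> \<Longrightarrow> \<beta> \<sqsubseteq> \<gamma> \<Longrightarrow> \<alpha> \<sqsubseteq> \<gamma>"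
  by (auto simp: info_le_def)

lemma info_le_antisym: "\<alpha> \<sqsubseteq> \<beta> \<Longrightarrow> \<beta> \<sqsubseteq> \<alpha> \<Longrightarrow> \<alpha> = \<beta>"
  by (auto simp: info_le_def prod_eq_iff)

lemma info_Join_in_cidl: "info_Join Cp Cm A \<in> cidl Cp \<times> cidl Cm"
  by (simp add: info_Join_def cjoin_in_cidl)

lemma info_Join_upper: "\<alpha> \<in> A \<Longrightarrow> \<alpha> \<sqsubseteq> info_Join Cp Cm A"
  by (simp add: info_Join_def info_le_def cjoin_upper)

lemma info_Join_least:
  assumes "\<beta> \<in> cidl Cp \<times> cidl Cm" and "\<And>\<alpha>. \<alpha> \<in> A \<Longrightarrow> \<alpha> \<sqsubseteq> \<beta>"
  shows "info_Join Cp Cm A \<sqsubseteq> \<beta>"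
  using assms unfolding info_Join_def info_le_def fst_conv snd_conv
  by (intro conjI cjoin_least) (auto simp: mem_Times_iff)

lemma dir_closureI:
  assumes "A \<subseteq> R" and "info_directed A" and "info_Join Cp Cm A = \<alpha>"
  shows "\<alpha> \<in> dir_closure Cp Cm R"
  using assms unfolding dir_closure_def by (intro CollectI exI[of _ A]) simp

lemma dir_closure_in_cidl: "dir_closure Cp Cm R \<subseteq> cidl Cp \<times> cidl Cm"
proof
  fix \<alpha> assume "\<alpha> \<in> dir_closure Cp Cm R"
  then show "\<alpha> \<in> cidl Cp \<times> cidl Cm"
    using info_Join_in_cidl unfolding dir_closure_def by blast
qed

text \<open>Singletons are directed. The join of a singleton returns its element because the
  components are ideals.\<close>

lemma dir_closure_increasing:
  assumes "R \<subseteq> cidl Cp \<times> cidl Cm"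
  shows "R \<subseteq> dir_closure Cp Cm R"
proof
  fix \<alpha> assume "\<alpha> \<in> R"
  then have "info_Join Cp Cm {\<alpha>} = \<alpha>"
    using assms by (intro info_le_antisym info_Join_least info_Join_upper) (auto simp: info_le_refl)
  moreover have "info_directed {\<alpha>}"
    by (simp add: info_directed_def info_le_refl)
  ultimately show "\<alpha> \<in> dir_closure Cp Cm R"
    using \<open>\<alpha> \<in> R\<close> by (intro dir_closureI[of "{\<alpha>}"]) auto
qed

section \<open>Base elements below an ideal and their independence\<close>

lemma cjoin_base_below:
  assumes "I \<in> cidl C"
  shows "cjoin C (base_below C I) = I"
proof
  show "cjoin C (base_below C I) \<subseteq> I"
    using assms by (rule cjoin_least) (simp add: base_below_def)
  show "I \<subseteq> cjoin C (base_below C I)"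
  proof
    fix x assume "x \<in> I"
    \<comment> \<open>The base element generated by \<open>x\<close> contains \<open>x\<close>, and
      it lies below \<open>I\<close> because \<open>I\<close> is an ideal containing
      \<open>x\<close>.\<close>
    then have "cgen C {x} \<in> base_below C I"
      using cgen_least[OF assms] by (simp add: base_below_def cbase_def)
    then show "x \<in> cjoin C (base_below C I)"
      using cgen_upper[of "{x}" C] cjoin_upper[of "cgen C {x}" "base_below C I" C] by blast
  qed
qed

lemma base_below_nonempty:
  assumes "I \<in> cidl C" and "I \<noteq> {}"
  shows "base_below C I \<noteq> {}"
proof -
  obtain x where "x \<in> I"
    using assms(2) by blast
  then have "cgen C {x} \<in> base_below C I"
    using cgen_least[OF assms(1)] by (simp add: base_below_def cbase_def)
  then show ?thesis by blast
qed

lemma base_below_mono: "I \<subseteq> J \<Longrightarrow> base_below C I \<subseteq> base_below C J"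
  by (auto simp: base_below_def)

lemma base_below_in_cidl: "base_below C I \<subseteq> cidl C"
  by (auto simp: base_below_def cbase_def cgen_in_cidl)

text \<open>Rewrites a join of arbitrary ideals as a join of base elements, the form that membership
  in \<open>base_closure\<close> asks for.\<close>

lemma cjoin_UN_base_below:
  assumes "F \<subseteq> cidl C"
  shows "cjoin C (\<Union>I\<in>F. base_below C I) = cjoin C F"
proof
  show "cjoin C (\<Union>I\<in>F. base_below C I) \<subseteq> cjoin C F"
  proof (rule cjoin_least[OF cjoin_in_cidl])
    fix J assume "J \<in> (\<Union>I\<in>F. base_below C I)"
    then obtain I where "I \<in> F" "J \<subseteq> I"
      by (auto simp: base_below_def)
    then show "J \<subseteq> cjoin C F"
      using cjoin_upper by blast
  qed
  show "cjoin C F \<subseteq> cjoin C (\<Union>I\<in>F. base_below C I)"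
  proof (rule cjoin_least[OF cjoin_in_cidl])
    fix I assume "I \<in> F"
    then have "cjoin C (base_below C I) \<subseteq> cjoin C (\<Union>I\<in>F. base_below C I)"
      by (intro cjoin_least[OF cjoin_in_cidl] cjoin_upper) blast
    then show "I \<subseteq> cjoin C (\<Union>I\<in>F. base_below C I)"
      using cjoin_base_below[of I C] assms \<open>I \<in> F\<close> by auto
  qed
qed

text \<open>A base element below the join need not lie below any member of \<open>A\<close>. Hence
  the detour: directedness relates the base elements below members, this places \<alpha> in
  \<open>base_closure\<close>, and \<open>ind\<close> covers the rest.\<close>

lemma independent_base_below_info_Join:
  assumes ind: "\<And>\<alpha>. \<alpha> \<in> base_closure Cp Cm R \<Longrightarrow>
      independent R (base_below Cp (fst \<alpha>)) (base_below Cm (snd \<alpha>))"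
    and A: "A \<subseteq> cidl Cp \<times> cidl Cm" "info_directed A"
    and indA: "\<And>\<beta>. \<beta> \<in> A \<Longrightarrow> independent R (base_below Cp (fst \<beta>)) (base_below Cm (snd \<beta>))"
    and \<alpha>: "\<alpha> = info_Join Cp Cm A"
  shows "independent R (base_below Cp (fst \<alpha>)) (base_below Cm (snd \<alpha>))"
proof (rule ind)
  let ?Ap = "\<Union>I\<in>fst ` A. base_below Cp I" and ?Am = "\<Union>I\<in>snd ` A. base_below Cm I"
  have "(b, c) \<in> R" if "\<beta> \<in> A" "b \<in> base_below Cp (fst \<beta>)" "\<gamma> \<in> A" "c \<in> base_below Cm (snd \<gamma>)"
    for \<beta> \<gamma> b c
  proof -
    \<comment> \<open>\<open>b\<close> and \<open>c\<close> may come from different members of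
      \<open>A\<close>; a common upper bound has both below it.\<close>
    obtain \<delta> where "\<delta> \<in> A" "\<beta> \<sqsubseteq> \<delta>" "\<gamma> \<sqsubseteq> \<delta>"
      using A(2) \<open>\<beta> \<in> A\<close> \<open>\<gamma> \<in> A\<close> unfolding info_directed_def by blast
    moreover have "b \<in> base_below Cp (fst \<delta>)" "c \<in> base_below Cm (snd \<delta>)"
      using that \<open>\<beta> \<sqsubseteq> \<delta>\<close> \<open>\<gamma> \<sqsubseteq> \<delta>\<close> by (auto simp: info_le_def dest: base_below_mono)
    ultimately show ?thesis
      using indA by (auto simp: independent_def)
  qed
  then have "independent R ?Ap ?Am"
    unfolding independent_def by blast
  moreover have "?Ap \<subseteq> cbase Cp" "?Am \<subseteq> cbase Cm"
    by (auto simp: base_below_def)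
  moreover have "\<alpha> = (cjoin Cp ?Ap, cjoin Cm ?Am)"
  proof -
    have "fst ` A \<subseteq> cidl Cp" "snd ` A \<subseteq> cidl Cm"
      using A(1) by auto
    then show ?thesis
      by (simp only: \<alpha> info_Join_def cjoin_UN_base_below)
  qed
  ultimately show "\<alpha> \<in> base_closure Cp Cm R"
    unfolding base_closure_def by blast
qed

section \<open>Directed subsets of \<open>R\<close> with a prescribed join\<close>

inductive_set join_closure :: "('a::order set \<times> 'a) set \<Rightarrow> 'a set set \<Rightarrow> 'a set set"
  for C F where
  base: "I \<in> F \<Longrightarrow> I \<in> join_closure C F"
| join: "I \<in> join_closure C F \<Longrightarrow> J \<in> join_closure C F \<Longrightarrow> cjoin C {I, J} \<in> join_closure C F"

lemma join_closure_base_below_le: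
  assumes "I \<in> join_closure C (base_below C J)" and "J \<in> cidl C"
  shows "I \<subseteq> J"
  using assms(1)
proof induction
  case (base I)
  then show ?case by (simp add: base_below_def)
next
  case (join I I')
  then show ?case by (intro cjoin_least[OF assms(2)]) auto
qed

text \<open>For two pairs sharing a component, one logical operation joins the other components and
  keeps the shared one, since an intersection \<open>J \<inter> J\<close> is \<open>J\<close>. So
  one side can be enlarged by binary joins while the other stays fixed: first the left side against
  \<open>G\<close>, then the right side against the enlarged left one.\<close>

lemma independent_join_closure:
  assumes meet: "\<And>\<alpha> \<beta>. \<alpha> \<in> R \<Longrightarrow> \<beta> \<in> R \<Longrightarrow> logical_meet Cm \<alpha> \<beta> \<in> R"
    and join: "\<And>\<alpha> \<beta>. \<alpha> \<in> R \<Longrightarrow> \<beta> \<in> R \<Longrightarrow> logical_join Cp \<alpha> \<beta> \<in> R"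
    and ind: "independent R F G"
  shows "independent R (join_closure Cp F) (join_closure Cm G)"
proof -
  have left: "(I, J) \<in> R" if "I \<in> join_closure Cp F" "J \<in> G" for I J
    using that
  proof induction
    case (base I)
    then show ?case using ind by (simp add: independent_def)
  next
    case (join I I')
    then show ?case using assms(2)[of "(I, J)" "(I', J)"] by (simp add: logical_join_def)
  qed
  have "(I, J) \<in> R" if "J \<in> join_closure Cm G" "I \<in> join_closure Cp F" for I J
    using that
  proof induction
    case (base J)
    then show ?case using left by simp
  next
    case (join J J')
    then show ?case using meet[of "(I, J)" "(I, J')"] by (simp add: logical_meet_def)
  qed
  then show ?thesis by (simp add: independent_def)
qed

text \<open>The directed set is the product of the two join closures. Independence puts it inside
  \<open>R\<close>, and the nonempty components of \<alpha> provide a base element on each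
  side.\<close>

lemma independent_base_below_in_dir_closure:
  assumes meet: "\<And>\<alpha> \<beta>. \<alpha> \<in> R \<Longrightarrow> \<beta> \<in> R \<Longrightarrow> logical_meet Cm \<alpha> \<beta> \<in> R"
    and join: "\<And>\<alpha> \<beta>. \<alpha> \<in> R \<Longrightarrow> \<beta> \<in> R \<Longrightarrow> logical_join Cp \<alpha> \<beta> \<in> R"
    and ind: "independent R (base_below Cp (fst \<alpha>)) (base_below Cm (snd \<alpha>))"
    and \<alpha>: "\<alpha> \<in> cidl Cp \<times> cidl Cm" "fst \<alpha> \<noteq> {}" "snd \<alpha> \<noteq> {}"
  shows "\<alpha> \<in> dir_closure Cp Cm R"
proof -
  let ?F = "base_below Cp (fst \<alpha>)" and ?G = "base_below Cm (snd \<alpha>)"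
  let ?S = "join_closure Cp ?F \<times> join_closure Cm ?G"
  have cidl: "fst \<alpha> \<in> cidl Cp" "snd \<alpha> \<in> cidl Cm"
    using \<alpha>(1) by auto
  have ne: "?F \<noteq> {}" "?G \<noteq> {}"
    using cidl \<alpha>(2,3) by (auto dest: base_below_nonempty)
  have sub: "?F \<subseteq> join_closure Cp ?F" "?G \<subseteq> join_closure Cm ?G"
    by (auto intro: join_closure.base)
  have "?S \<subseteq> R"
    using independent_join_closure[OF meet join ind] by (auto simp: independent_def)
  moreover have "info_directed ?S"
    unfolding info_directed_def
  proof (intro conjI ballI)
    show "?S \<noteq> {}" using ne sub by blast
  next
    fix \<beta> \<gamma> assume "\<beta> \<in> ?S" "\<gamma> \<in> ?S"
    \<comment> \<open>The witness joins both components at once, which neither logical operation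
      does in general; it stays in \<open>?S\<close> because each factor is closed under binary
      joins.\<close>
    then show "\<exists>\<delta>\<in>?S. \<beta> \<sqsubseteq> \<delta> \<and> \<gamma> \<sqsubseteq> \<delta>"
      by (intro bexI[of _ "(cjoin Cp {fst \<beta>, fst \<gamma>}, cjoin Cm {snd \<beta>, snd \<gamma>})"])
        (simp_all add: info_le_def cjoin_upper join_closure.join mem_Times_iff)
  qed
  moreover have "info_Join Cp Cm ?S = \<alpha>"
  proof (rule info_le_antisym)
    show "info_Join Cp Cm ?S \<sqsubseteq> \<alpha>"
    proof (rule info_Join_least[OF \<alpha>(1)])
      fix \<beta> assume "\<beta> \<in> ?S"
      then have "fst \<beta> \<in> join_closure Cp ?F" "snd \<beta> \<in> join_closure Cm ?G"
        by auto
      then show "\<beta> \<sqsubseteq> \<alpha>"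
        using cidl by (simp add: info_le_def join_closure_base_below_le)
    qed
    \<comment> \<open>Projecting the product recovers each factor because the other one is
      nonempty.\<close>
    have "fst ` ?S = join_closure Cp ?F" "snd ` ?S = join_closure Cm ?G"
      using ne sub by (simp_all only: fst_image_times snd_image_times) auto
    moreover have "cjoin Cp ?F \<subseteq> cjoin Cp (join_closure Cp ?F)"
      "cjoin Cm ?G \<subseteq> cjoin Cm (join_closure Cm ?G)"
      using sub by (intro cjoin_least[OF cjoin_in_cidl] cjoin_upper; blast)+
    ultimately show "\<alpha> \<sqsubseteq> info_Join Cp Cm ?S"
      using cidl by (simp add: info_le_def info_Join_def cjoin_base_below)
  qed
  ultimately show ?thesis
    by (rule dir_closureI)
qed

text \<open>Each member of the outer directed set is a join of elements of \<open>R\<close>, and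
  these lie below \<alpha> as well. So the elements of \<open>R\<close> below \<alpha> together
  recover it; whether they form a directed set is a separate matter.\<close>

lemma dir_closure_dir_closure_lower:
  assumes "\<alpha> \<in> dir_closure Cp Cm (dir_closure Cp Cm R)"
  shows "{\<beta> \<in> R. \<beta> \<sqsubseteq> \<alpha>} \<noteq> {}" and "info_Join Cp Cm {\<beta> \<in> R. \<beta> \<sqsubseteq> \<alpha>} = \<alpha>"
proof -
  let ?S = "{\<beta> \<in> R. \<beta> \<sqsubseteq> \<alpha>}"
  obtain A where A: "A \<subseteq> dir_closure Cp Cm R" "info_directed A" "\<alpha> = info_Join Cp Cm A"
    using assms unfolding dir_closure_def by blast
  have part: "?S \<noteq> {} \<and> \<beta> \<sqsubseteq> info_Join Cp Cm ?S" if \<beta>: "\<beta> \<in> A" for \<beta>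
  proof -
    obtain A' where A': "A' \<subseteq> R" "info_directed A'" "\<beta> = info_Join Cp Cm A'"
      using subsetD[OF A(1) \<beta>] unfolding dir_closure_def by blast
    have "\<beta> \<sqsubseteq> \<alpha>"
      using that by (simp add: A(3) info_Join_upper)
    then have "A' \<subseteq> ?S"
      using A'(1,3) info_Join_upper info_le_trans by blast
    moreover have "A' \<noteq> {}"
      using A'(2) by (simp add: info_directed_def)
    moreover have "\<beta> \<sqsubseteq> info_Join Cp Cm ?S"
      unfolding A'(3) using \<open>A' \<subseteq> ?S\<close>
      by (intro info_Join_least[OF info_Join_in_cidl] info_Join_upper) blast
    ultimately show ?thesis by blast
  qed
  show "?S \<noteq> {}"
    using part A(2) unfolding info_directed_def by blast
  have "\<alpha> \<in> cidl Cp \<times> cidl Cm"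
    unfolding A(3) by (rule info_Join_in_cidl)
  then have "info_Join Cp Cm ?S \<sqsubseteq> \<alpha>"
    by (rule info_Join_least) simp
  moreover have "\<alpha> \<sqsubseteq> info_Join Cp Cm ?S"
    unfolding A(3) by (rule info_Join_least[OF info_Join_in_cidl]) (use part A(3) in blast)
  ultimately show "info_Join Cp Cm ?S = \<alpha>"
    by (rule info_le_antisym)
qed

text \<open>Everything below \<alpha> shares its empty component. The logical operation that
  intersects this component then joins both components, so it yields an upper bound in
  \<open>R\<close>: the meet if the first component is empty, the join if the second is.\<close>

lemma info_directed_lower_if_empty_component:
  assumes meet: "\<And>\<alpha> \<beta>. \<alpha> \<in> R \<Longrightarrow> \<beta> \<in> R \<Longrightarrow> logical_meet Cm \<alpha> \<beta> \<in> R"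
    and join: "\<And>\<alpha> \<beta>. \<alpha> \<in> R \<Longrightarrow> \<beta> \<in> R \<Longrightarrow> logical_join Cp \<alpha> \<beta> \<in> R"
    and \<alpha>: "\<alpha> \<in> cidl Cp \<times> cidl Cm" "fst \<alpha> = {} \<or> snd \<alpha> = {}"
    and ne: "{\<beta> \<in> R. \<beta> \<sqsubseteq> \<alpha>} \<noteq> {}"
  shows "info_directed {\<beta> \<in> R. \<beta> \<sqsubseteq> \<alpha>}"
  unfolding info_directed_def
proof (intro conjI ballI)
  fix \<beta> \<gamma> assume \<beta>: "\<beta> \<in> {\<beta> \<in> R. \<beta> \<sqsubseteq> \<alpha>}" and \<gamma>: "\<gamma> \<in> {\<beta> \<in> R. \<beta> \<sqsubseteq> \<alpha>}"
  have le: "cjoin Cp {fst \<beta>, fst \<gamma>} \<subseteq> fst \<alpha>" "cjoin Cm {snd \<beta>, snd \<gamma>} \<subseteq> snd \<alpha>"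
    using \<alpha>(1) \<beta> \<gamma> by (intro cjoin_least; auto simp: info_le_def mem_Times_iff)+
  have ub: "fst \<beta> \<subseteq> cjoin Cp {fst \<beta>, fst \<gamma>}" "fst \<gamma> \<subseteq> cjoin Cp {fst \<beta>, fst \<gamma>}"
    "snd \<beta> \<subseteq> cjoin Cm {snd \<beta>, snd \<gamma>}" "snd \<gamma> \<subseteq> cjoin Cm {snd \<beta>, snd \<gamma>}"
    by (simp_all add: cjoin_upper)
  from \<alpha>(2) show "\<exists>\<delta>\<in>{\<beta> \<in> R. \<beta> \<sqsubseteq> \<alpha>}. \<beta> \<sqsubseteq> \<delta> \<and> \<gamma> \<sqsubseteq> \<delta>"
  proof
    assume "fst \<alpha> = {}"
    then show ?thesis
      using meet[of \<beta> \<gamma>] \<beta> \<gamma> le ub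
      by (intro bexI[of _ "logical_meet Cm \<beta> \<gamma>"]) (auto simp: info_le_def logical_meet_def)
  next
    assume "snd \<alpha> = {}"
    then show ?thesis
      using join[of \<beta> \<gamma>] \<beta> \<gamma> le ub
      by (intro bexI[of _ "logical_join Cp \<beta> \<gamma>"]) (auto simp: info_le_def logical_join_def)
  qed
qed (rule ne)

section \<open>Independence along the two closure steps, then the case split on empty
  components\<close>

theorem theorem10:
  fixes Cp :: "('a::bounded_semilattice_inf_top set \<times> 'a) set"
    and Cm :: "('b::bounded_semilattice_inf_top set \<times> 'b) set"
    and R :: "('a set \<times> 'b set) set"
  assumes "frame_presentation Cp"
    and "frame_presentation Cm"
    and "R \<subseteq> cidl Cp \<times> cidl Cm"
    and "\<And>\<alpha> \<beta>. \<alpha> \<in> R \<Longrightarrow> \<beta> \<in> cidl Cp \<times> cidl Cm \<Longrightarrow> \<beta> \<sqsubseteq> \<alpha> \<Longrightarrow> \<beta> \<in> R"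
    and "\<And>\<alpha> \<beta>. \<alpha> \<in> R \<Longrightarrow> \<beta> \<in> R \<Longrightarrow> logical_meet Cm \<alpha> \<beta> \<in> R"
    and "\<And>\<alpha> \<beta>. \<alpha> \<in> R \<Longrightarrow> \<beta> \<in> R \<Longrightarrow> logical_join Cp \<alpha> \<beta> \<in> R"
    and "\<And>\<alpha>. \<alpha> \<in> base_closure Cp Cm R \<Longrightarrow>
           independent R (base_below Cp (fst \<alpha>)) (base_below Cm (snd \<alpha>))"
  shows "dir_closure Cp Cm (dir_closure Cp Cm R) = dir_closure Cp Cm R"
proof
  let ?D = "dir_closure Cp Cm"
  let ?ind = "\<lambda>\<alpha>. independent R (base_below Cp (fst \<alpha>)) (base_below Cm (snd \<alpha>))"
  show "?D R \<subseteq> ?D (?D R)"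
    by (rule dir_closure_increasing[OF dir_closure_in_cidl])
  \<comment> \<open>Independence refers to \<open>R\<close> throughout while \<open>S\<close>
    varies: \<open>S = R\<close> carries it to \<open>?D R\<close>, and \<open>S = ?D R\<close>
    carries it on to \<open>?D (?D R)\<close>.\<close>
  have lift: "?ind \<alpha>" if "S \<subseteq> cidl Cp \<times> cidl Cm" "\<And>\<beta>. \<beta> \<in> S \<Longrightarrow> ?ind \<beta>" "\<alpha> \<in> ?D S" for S \<alpha>
  proof -
    obtain A where A: "A \<subseteq> S" "info_directed A" "\<alpha> = info_Join Cp Cm A"
      using \<open>\<alpha> \<in> ?D S\<close> unfolding dir_closure_def by blast
    show ?thesis
      by (rule independent_base_below_info_Join[OF assms(7) _ A(2) _ A(3)]) (use A(1) that in auto)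
  qed
  \<comment> \<open>Downward closure enters here: base elements below the two components of \<alpha>
    form a pair below \<alpha> in the information order.\<close>
  have "?ind \<alpha>" if "\<alpha> \<in> R" for \<alpha>
    unfolding independent_def
  proof (intro ballI)
    fix b c assume bc: "b \<in> base_below Cp (fst \<alpha>)" "c \<in> base_below Cm (snd \<alpha>)"
    show "(b, c) \<in> R"
    proof (rule assms(4)[OF \<open>\<alpha> \<in> R\<close>])
      show "(b, c) \<in> cidl Cp \<times> cidl Cm"
        using bc by (auto dest: base_below_in_cidl[THEN subsetD])
      show "(b, c) \<sqsubseteq> \<alpha>"
        using bc by (simp add: base_below_def info_le_def)
    qed
  qed
  then have "?ind \<alpha>" if "\<alpha> \<in> ?D R" for \<alpha>
    using lift[OF assms(3)] that by blast
  then have ind: "?ind \<alpha>" if "\<alpha> \<in> ?D (?D R)" for \<alpha>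
    using lift[OF dir_closure_in_cidl] that by blast
  show "?D (?D R) \<subseteq> ?D R"
  proof
    fix \<alpha> assume \<alpha>: "\<alpha> \<in> ?D (?D R)"
    then have cidl: "\<alpha> \<in> cidl Cp \<times> cidl Cm"
      using dir_closure_in_cidl by blast
    show "\<alpha> \<in> ?D R"
    \<comment> \<open>With an empty component, \<open>ind\<close> is vacuous and cannot produce
      elements of \<open>R\<close>; the lower set of \<alpha> in \<open>R\<close> takes
      over.\<close>
    proof (cases "fst \<alpha> = {} \<or> snd \<alpha> = {}")
      case True
      let ?S = "{\<beta> \<in> R. \<beta> \<sqsubseteq> \<alpha>}"
      have "info_directed ?S"
        by (rule info_directed_lower_if_empty_component[OF assms(5,6) cidl True
              dir_closure_dir_closure_lower(1)[OF \<alpha>]])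
      then show ?thesis
        using dir_closure_dir_closure_lower(2)[OF \<alpha>] by (intro dir_closureI[of ?S]) auto
    next
      case False
      then show ?thesis
        using independent_base_below_in_dir_closure[OF assms(5,6) ind[OF \<alpha>] cidl] by simp
    qed
  qed
qed

end
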